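(* Let $m \ge 3$ be odd and $n = 3^m-1$. Then the ternary cyclic code $\mathcal{C}_{(2,3,m)}$ has parameters $[n,k,d]$ with $d \ge \frac{3^{(m-1)/2}+7}{2}$ if $m \equiv 3 \pmod 4$ and $d \ge \frac{3^{(m-1)/2}+5}{2}$ if $m \equiv 1 \pmod 4$, and $k = \frac{n}{2}$ if $m \equiv 3 \pmod 4$ and $k = \frac{n+2}{2}$ if $m \equiv 1 \pmod 4$.
   Context: Let $m \ge 2$ be an integer, $n = 3^m-1$, and let $\alpha$ be a primitive element of $\mathbb{F}_{3^m}$. For an integer $0 \le j \le n-1$ with $3$-adic expansion $j = \sum_{t=0}^{m-1} j_t 3^t$, $j_t \in \{0,1,2\}$, let $w_3(j) = \sum_{t=0}^{m-1} j_t$. For distinct $i_1, i_2 \in \{0,1,2,3\}$ let $T_{(i_1,i_2,m)} = \{1 \le j \le n-1 : w_3(j) \equiv i_1 \text{ or } i_2 \pmod 4\}$ and $g_{(i_1,i_2,m)}(x) = \prod_{j \in T_{(i_1,i_2,m)}} (x - \alpha^j) \in \mathbb{F}_3[x]$. $\mathcal{C}_{(i_1,i_2,m)}$ denotes the ternary cyclic code of length $n$ with generator polynomial $g_{(i_1,i_2,m)}(x)$. Parameters $[n,k,d]$ mean length, dimension over $\mathbb{F}_3$, and minimum Hamming distance. *)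

theory Defs
  imports "HOL-Computational_Algebra.Polynomial"
begin

fun w3 :: "nat \<Rightarrow> nat" where
  "w3 j = (if j = 0 then 0 else j mod 3 + w3 (j div 3))"

text \<open>The field F_{3^m} is modelled by a finite field type 'a with card 3^m;
  F_3 is its prime subfield.\<close>
definition prime_subfield :: "'a::field set" where
  "prime_subfield = range (of_nat :: nat \<Rightarrow> 'a)"

definition primitive_element :: "'a::field \<Rightarrow> bool" where
  "primitive_element \<alpha> \<longleftrightarrow> \<alpha> \<noteq> 0 \<and> (\<forall>x. x \<noteq> 0 \<longrightarrow> (\<exists>i::nat. \<alpha> ^ i = x))"

definition T_set :: "nat \<Rightarrow> nat \<Rightarrow> nat \<Rightarrow> nat set" where
  "T_set i1 i2 m = {j. 1 \<le> j \<and> j \<le> 3 ^ m - 2 \<and> (w3 j mod 4 = i1 \<or> w3 j mod 4 = i2)}"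

definition gen_poly :: "'a::field \<Rightarrow> nat \<Rightarrow> nat \<Rightarrow> nat \<Rightarrow> 'a poly" where
  "gen_poly \<alpha> i1 i2 m = (\<Prod>j\<in>T_set i1 i2 m. [:- (\<alpha> ^ j), 1:])"

text \<open>Cyclic code of length n over F_3 generated by g: codewords are the
  polynomials over F_3 of degree < n that are multiples of g (g divides x^n - 1).\<close>
definition cyclic_code :: "nat \<Rightarrow> 'a::field poly \<Rightarrow> 'a poly set" where
  "cyclic_code n g = {c. (\<forall>i. coeff c i \<in> prime_subfield) \<and> (c = 0 \<or> degree c < n) \<and> g dvd c}"

definition hweight :: "'a::zero poly \<Rightarrow> nat" where
  "hweight c = card {i. coeff c i \<noteq> 0}"

definition code_dim :: "'a poly set \<Rightarrow> nat" where
  "code_dim C = (THE k. card C = 3 ^ k)"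

definition min_dist :: "'a::zero poly set \<Rightarrow> nat" where
  "min_dist C = Min (hweight ` (C - {0}))"

definition code_C :: "'a::field \<Rightarrow> nat \<Rightarrow> nat \<Rightarrow> nat \<Rightarrow> 'a poly set" where
  "code_C \<alpha> i1 i2 m = cyclic_code (3 ^ m - 1) (gen_poly \<alpha> i1 i2 m)"

end

theory Submission
  imports Defs
begin

text \<open>
  Write $m = 2h + 1$, $P = 3^h$, $n = 3P^2 - 1$ and $w = w_3$.

  Dimension: the defining set $T$ is stable under $j \mapsto 3j$, so the generator is fixed by
  Frobenius and $k = n - |T|$. The size of $T$ comes from summing the sign that is $+1$ on the
  residues $2, 3$ and $-1$ on $0, 1$ modulo 4: three consecutive signs add up to the middle one,
  so adding a ternary digit just shifts the argument and the sum over $w(j)$, $j < 3^m$, is the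
  sign of $m$.

  Distance: by the BCH bound it suffices to find $b$ prime to $n$ such that $b, 2b, \ldots$ stay in
  $T$ modulo $n$ for long enough. Take $b = n/2 - (P + 1)$ for even $h$ and $b = n/2 + (P - 1)$
  for odd $h > 1$. For even $i$ the term $n/2$ disappears from $bi$, leaving $-(P + 1)i$ of weight
  $2m - 2w(i)$, resp. $(P - 1)i$ of weight $2h$. For odd $i$ one uses
  $n/2 = P^2 + (P + 1)(P - 1)/2$ and reads off the three blocks of digits. For $h = 1$ the second
  choice of $b$ is one term short, and the run $4, 5, 6, 7$ replaces it.
\<close>

section \<open>Ternary digit sums\<close>

declare w3.simps [simp del]

lemma w3_0 [simp]: "w3 0 = 0"
  by (simp add: w3.simps)

lemma w3_step: "d < 3 \<Longrightarrow> w3 (3 * a + d) = d + w3 a"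
  by (cases "3 * a + d = 0") (auto simp: w3.simps[of "3 * a + d"])

lemma w3_digit: "d < 3 \<Longrightarrow> w3 d = d"
  using w3_step[of d 0] by simp

lemma w3_append: "r < 3 ^ k \<Longrightarrow> w3 (3 ^ k * a + r) = w3 a + w3 r"
proof (induction k arbitrary: r)
  case (Suc k)
  have r: "r = 3 * (r div 3) + r mod 3" by simp
  have "3 ^ Suc k * a + r = 3 * (3 ^ k * a + r div 3) + r mod 3"
    using r by (simp add: algebra_simps)
  hence "w3 (3 ^ Suc k * a + r) = r mod 3 + w3 (3 ^ k * a + r div 3)"
    using w3_step[of "r mod 3" "3 ^ k * a + r div 3"] by (simp only:)
  also have "\<dots> = r mod 3 + (w3 a + w3 (r div 3))"
    using Suc.IH[of "r div 3"] Suc.prems by (simp add: less_mult_imp_div_less mult.commute)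
  also have "\<dots> = w3 a + w3 r"
    using w3_step[of "r mod 3" "r div 3"] by simp
  finally show ?case .
qed simp

text \<open>Subtraction from \<open>3 ^ k - 1\<close> turns every ternary digit \<open>x\<close>
  into \<open>2 - x\<close> without borrowing. This gives the weights of negatives modulo
  \<open>3 ^ m - 1\<close>.\<close>

lemma w3_complement: "r < 3 ^ k \<Longrightarrow> w3 r + w3 (3 ^ k - 1 - r) = 2 * k"
proof (induction k arbitrary: r)
  case (Suc k)
  have q: "r div 3 < 3 ^ k"
    using Suc.prems by (simp add: less_mult_imp_div_less mult.commute)
  have "3 ^ Suc k - 1 - r = 3 * (3 ^ k - 1 - r div 3) + (2 - r mod 3)"
    using q by (simp) presburger
  hence "w3 (3 ^ Suc k - 1 - r) = (2 - r mod 3) + w3 (3 ^ k - 1 - r div 3)"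
    using w3_step[of "2 - r mod 3"] by simp
  moreover have "w3 r = r mod 3 + w3 (r div 3)"
    using w3_step[of "r mod 3" "r div 3"] by simp
  moreover have "r mod 3 \<le> 2" by presburger
  ultimately show ?case using Suc.IH[OF q] by simp
qed simp

text \<open>Since 3 is odd, a number and its digit sum agree modulo 2. Hence the parity of
  \<open>i\<close> alone determines \<open>2 * w3 i\<close> modulo 4.\<close>

lemma even_w3_iff: "even (w3 j) \<longleftrightarrow> even j"
proof (induction j rule: less_induct)
  case (less j)
  show ?case
  proof (cases "j = 0")
    case False
    have "even (w3 (j div 3)) \<longleftrightarrow> even (j div 3)" using False by (intro less) simp
    moreover have "w3 j = j mod 3 + w3 (j div 3)"
      using w3_step[of "j mod 3" "j div 3"] by simp
    moreover have "even (j mod 3 + j div 3) \<longleftrightarrow> even j" by presburger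
    ultimately show ?thesis by simp
  qed simp
qed

section \<open>Size of the defining set\<close>

definition residue_sign :: "nat \<Rightarrow> int" where
  "residue_sign w = (if w mod 4 = 2 \<or> w mod 4 = 3 then 1 else - 1)"

text \<open>A shift by 2 flips the sign, so the two outer terms cancel.\<close>

lemma residue_sign_block:
  "residue_sign w + residue_sign (w + 1) + residue_sign (w + 2) = residue_sign (w + 1)"
proof -
  have "w mod 4 = 0 \<or> w mod 4 = 1 \<or> w mod 4 = 2 \<or> w mod 4 = 3" by presburger
  thus ?thesis unfolding residue_sign_def by (elim disjE) (simp_all add: mod_add_eq[of w, symmetric] mod_simps, presburger+)
qed

lemma sum_lessThan_times_3:
  fixes f :: "nat \<Rightarrow> int"
  shows "(\<Sum>j<3 * k. f j) = (\<Sum>j<k. f (3 * j) + f (3 * j + 1) + f (3 * j + 2))"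
  by (induction k) (simp_all add: algebra_simps eval_nat_numeral)

text \<open>The offset \<open>s\<close> carries the induction: summing over the lowest digit
  replaces \<open>s\<close> by \<open>s + 1\<close>.\<close>

lemma sum_residue_sign: "(\<Sum>j<3 ^ m. residue_sign (w3 j + s)) = residue_sign (m + s)"
proof (induction m arbitrary: s)
  case (Suc m)
  have "(\<Sum>j<3 ^ Suc m. residue_sign (w3 j + s))
      = (\<Sum>j<3 ^ m. residue_sign (w3 j + s) + residue_sign (w3 j + s + 1) + residue_sign (w3 j + s + 2))"
    using w3_step[of 0] w3_step[of 1] w3_step[of 2]
    by (simp add: sum_lessThan_times_3 add_ac numeral_2_eq_2)
  also have "\<dots> = (\<Sum>j<3 ^ m. residue_sign (w3 j + (s + 1)))"
    by (simp only: residue_sign_block) (simp only: add.assoc)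
  finally show ?case using Suc.IH[of "s + 1"] by simp
qed simp

lemma finite_T_set [simp]: "finite (T_set i1 i2 m)"
  by (rule finite_subset[of _ "{..3 ^ m - 2}"]) (auto simp: T_set_def)

text \<open>For odd \<open>m\<close> the weight \<open>2 * m\<close> of \<open>3 ^ m - 1\<close> is
  2 modulo 4, so this exponent meets the weight condition but lies just beyond the range of
  \<open>T_set\<close>. At the other end, 0 fails the condition anyway.\<close>

lemma T_set_23_eq:
  assumes "odd m"
  shows "insert (3 ^ m - 1) (T_set 2 3 m) = {j. j < 3 ^ m \<and> residue_sign (w3 j) = 1}"
proof -
  have "w3 (3 ^ m - 1) mod 4 = 2"
    using w3_complement[of 0 m] assms by simp presburger
  moreover have "(0::nat) < 3 ^ m" by simp
  ultimately show ?thesis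
    by (auto simp: T_set_def residue_sign_def Suc_le_eq intro!: Nat.gr0I split: if_splits)
qed

lemma card_T_set_23:
  assumes "odd m"
  shows "2 * int (card (T_set 2 3 m)) = 3 ^ m + residue_sign m - 2"
proof -
  let ?A = "{j. j < 3 ^ m \<and> residue_sign (w3 j) = 1}"
  have "residue_sign (w3 j) = 2 * of_bool (j \<in> ?A) - 1" if "j < 3 ^ m" for j
    using that by (auto simp: residue_sign_def)
  hence "(\<Sum>j<3 ^ m. residue_sign (w3 j)) = (\<Sum>j<3 ^ m. 2 * of_bool (j \<in> ?A) - 1)"
    by (intro sum.cong) auto
  also have "\<dots> = 2 * (\<Sum>j<3 ^ m. of_bool (j \<in> ?A)) - 3 ^ m"
    by (simp add: sum_subtractf sum_distrib_left)
  also have "(\<Sum>j<3 ^ m. of_bool (j \<in> ?A)) = int (card ?A)"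
    by (subst sum_of_bool_eq) (auto intro!: arg_cong[where f = card])
  finally have "2 * int (card ?A) = 3 ^ m + residue_sign m"
    using sum_residue_sign[of 0 m] by simp
  moreover have "card ?A = card (T_set 2 3 m) + 1"
    unfolding T_set_23_eq[OF assms, symmetric]
    by (subst card_insert_disjoint) (auto simp: T_set_def)
  ultimately show ?thesis by simp
qed

section \<open>The BCH bound\<close>

text \<open>The run consists of \<open>d - 1\<close> consecutive exponents. In place of a
  Vandermonde determinant, a test polynomial \<open>p\<close> isolates one nonzero coefficient of a
  word that is too light, while the roots in the run force that coefficient to vanish.\<close>

lemma BCH_bound:
  fixes \<beta> :: "'a::field" and c :: "'a poly"
  assumes inj: "inj_on (\<lambda>i. \<beta> ^ i) {..<n}"
    and c: "c \<noteq> 0" "degree c < n"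
    and nz: "\<beta> \<noteq> 0"
    and roots: "\<And>t. a \<le> t \<Longrightarrow> t + 1 < a + d \<Longrightarrow> poly c (\<beta> ^ t) = 0"
  shows "d \<le> hweight c"
proof (rule ccontr)
  assume "\<not> d \<le> hweight c"
  hence less: "hweight c < d" by simp
  define S where "S = {i. coeff c i \<noteq> 0}"
  have S: "S \<subseteq> {..degree c}" unfolding S_def by (auto intro: le_degree)
  hence fin: "finite S" by (rule finite_subset) simp
  have Sn: "S \<subseteq> {..<n}" using S c(2) by auto
  define k where "k = degree c"
  have k: "k \<in> S" unfolding S_def k_def using c(1) by simp
  \<comment> \<open>Vanishes on the support except at \<open>k\<close>; the factor \<open>x ^ a\<close> kills the values of \<open>c\<close> before the run.\<close>
  define p where "p = monom 1 a * (\<Prod>s\<in>S - {k}. [:- (\<beta> ^ s), 1:])"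
  have "degree p = a + card (S - {k})"
    unfolding p_def
    by (subst degree_mult_eq) (auto simp: degree_prod_eq_sum_degree fin degree_monom_eq)
  moreover have "card S = Suc (card (S - {k}))"
    using card.remove[OF fin k] .
  \<comment> \<open>The \<open>card S - 1\<close> linear factors with \<open>card S < d\<close> keep
    every exponent of \<open>p\<close> below \<open>a + d - 1\<close>, hence inside the run or below
    \<open>a\<close>.\<close>
  ultimately have deg: "degree p + 1 < a + d" using less by (simp add: hweight_def S_def)
  have c_eval: "poly c x = (\<Sum>s\<in>S. coeff c s * x ^ s)" for x
    unfolding poly_altdef by (rule sum.mono_neutral_right) (use S in \<open>auto simp: S_def\<close>)
  \<comment> \<open>Both \<open>c\<close> and \<open>p\<close> are expanded into one double sum in
    \<open>\<beta> ^ (s * t)\<close>; exchanging the order trades values of \<open>p\<close> at the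
    support for values of \<open>c\<close> along the run.\<close>
  have "(\<Sum>s\<in>S. coeff c s * poly p (\<beta> ^ s))
      = (\<Sum>s\<in>S. \<Sum>t\<le>degree p. coeff p t * (coeff c s * (\<beta> ^ t) ^ s))"
    by (simp add: poly_altdef sum_distrib_left mult_ac power_mult[symmetric])
  also have "\<dots> = (\<Sum>t\<le>degree p. coeff p t * poly c (\<beta> ^ t))"
    by (subst sum.swap) (simp add: c_eval sum_distrib_left)
  also have "\<dots> = 0"
  proof (rule sum.neutral, safe)
    fix t assume "t \<le> degree p"
    show "coeff p t * poly c (\<beta> ^ t) = 0"
    proof (cases "t < a")
      case True
      thus ?thesis by (simp add: p_def coeff_monom_mult)
    next
      case False
      thus ?thesis using roots[of t] deg \<open>t \<le> degree p\<close> by simp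
    qed
  qed
  finally have "(\<Sum>s\<in>S. coeff c s * poly p (\<beta> ^ s)) = 0" .
  moreover have "(\<Sum>s\<in>S. coeff c s * poly p (\<beta> ^ s)) = coeff c k * poly p (\<beta> ^ k)"
  proof -
    have "poly p (\<beta> ^ s) = 0" if "s \<in> S - {k}" for s
      using that fin by (auto simp: p_def poly_prod poly_monom)
    thus ?thesis by (subst sum.remove[OF fin k]) simp
  qed
  moreover have "coeff c k \<noteq> 0" using k by (simp add: S_def)
  moreover have "poly p (\<beta> ^ k) \<noteq> 0"
  proof -
    have "\<beta> ^ k \<noteq> \<beta> ^ s" if "s \<in> S - {k}" for s
      using inj_onD[OF inj, of k s] Sn k that by auto
    thus ?thesis using nz fin by (simp add: p_def poly_prod poly_monom)
  qed
  ultimately show False by simp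
qed

section \<open>The order of a primitive element\<close>

lemma power_eq_1_imp_inj_on:
  fixes x :: "'a::field"
  assumes "x \<noteq> 0" and "\<And>i. x ^ i = 1 \<Longrightarrow> n dvd i"
  shows "inj_on (\<lambda>i. x ^ i) {..<n}"
proof (rule inj_onI)
  have *: "i = j" if "x ^ i = x ^ j" "i \<le> j" "j < n" for i j
  proof -
    have "x ^ i * x ^ (j - i) = x ^ j"
      using that(2) by (simp flip: power_add)
    hence "x ^ i * x ^ (j - i) = x ^ i * 1" using that(1) by simp
    hence "x ^ (j - i) = 1" using assms(1) by simp
    hence "n dvd j - i" by (rule assms(2))
    hence "j - i = 0" using that(3) nat_dvd_not_less[of "j - i" n] by fastforce
    with that(2) show ?thesis by simp
  qed
  fix i j assume "i \<in> {..<n}" "j \<in> {..<n}" "x ^ i = x ^ j"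
  thus "i = j" using *[of i j] *[of j i] by (cases "i \<le> j") auto
qed

text \<open>Finiteness gives a least positive exponent \<open>e\<close> with value 1. The powers
  below \<open>e\<close> are distinct and exhaust the nonzero elements, so \<open>e\<close> is their
  number.\<close>

lemma primitive_element_power_eq_1_iff:
  fixes \<alpha> :: "'a::{field,finite}"
  assumes "primitive_element \<alpha>"
  shows "\<alpha> ^ i = 1 \<longleftrightarrow> (card (UNIV :: 'a set) - 1) dvd i"
proof -
  have nz: "\<alpha> \<noteq> 0" and gen: "\<And>x. x \<noteq> 0 \<Longrightarrow> \<exists>i::nat. \<alpha> ^ i = x"
    using assms by (auto simp: primitive_element_def)
  define e where "e = (LEAST e. 0 < e \<and> \<alpha> ^ e = 1)"
  have ex: "\<exists>e. 0 < e \<and> \<alpha> ^ e = 1"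
  proof -
    have "\<not> inj (\<lambda>i::nat. \<alpha> ^ i)"
      using finite_imageD[of "\<lambda>i::nat. \<alpha> ^ i" UNIV] by auto
    then obtain i j :: nat where ij: "i < j" "\<alpha> ^ i = \<alpha> ^ j"
      by (metis injI linorder_neqE_nat)
    have "\<alpha> ^ i * \<alpha> ^ (j - i) = \<alpha> ^ j" using ij(1) by (simp flip: power_add)
    hence "\<alpha> ^ i * \<alpha> ^ (j - i) = \<alpha> ^ i * 1" using ij(2) by simp
    thus ?thesis using nz ij(1) by (intro exI[of _ "j - i"]) simp
  qed
  have e: "0 < e" "\<alpha> ^ e = 1" using LeastI_ex[OF ex] by (auto simp: e_def)
  have red: "\<alpha> ^ i = \<alpha> ^ (i mod e)" for i
  proof -
    have "\<alpha> ^ i = \<alpha> ^ (e * (i div e) + i mod e)" by simp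
    also have "\<dots> = \<alpha> ^ (i mod e)" unfolding power_add power_mult by (simp add: e)
    finally show ?thesis .
  qed
  have dvd: "\<alpha> ^ i = 1 \<longleftrightarrow> e dvd i" for i
  proof
    assume "\<alpha> ^ i = 1"
    hence "\<not> 0 < i mod e" using not_less_Least[of "i mod e" "\<lambda>e. 0 < e \<and> \<alpha> ^ e = 1"] red[of i] e(1)
      unfolding e_def[symmetric] by simp
    thus "e dvd i" by (simp add: dvd_eq_mod_eq_0)
  next
    assume "e dvd i" thus "\<alpha> ^ i = 1" using red[of i] by (simp add: dvd_eq_mod_eq_0)
  qed
  have "UNIV - {0} = (\<lambda>i. \<alpha> ^ i) ` {..<e}"
  proof safe
    fix x :: 'a assume "x \<notin> (\<lambda>i. \<alpha> ^ i) ` {..<e}"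
    moreover have "x \<in> (\<lambda>i. \<alpha> ^ i) ` {..<e}" if x: "x \<noteq> 0"
    proof -
      obtain i where "\<alpha> ^ i = x" using gen[OF x] by blast
      thus ?thesis using red[of i] e(1) by (intro image_eqI[of _ _ "i mod e"]) auto
    qed
    ultimately show "x = 0" by blast
  qed (use nz in auto)
  hence "card (UNIV - {0 :: 'a}) = card ((\<lambda>i. \<alpha> ^ i) ` {..<e})" by simp
  also have "\<dots> = e"
    using power_eq_1_imp_inj_on[of \<alpha> e] nz dvd by (simp add: card_image)
  finally show ?thesis using dvd by (simp add: card_Diff_singleton)
qed

section \<open>Characteristic 3 and the Frobenius map on polynomials\<close>

text \<open>The translation by 1 permutes the field, so it leaves the sum of all elements
  unchanged.\<close>

lemma of_nat_card_UNIV_eq_0: "of_nat (card (UNIV :: 'a set)) = (0 :: 'a::{field,finite})"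
proof -
  have "(\<Sum>x\<in>(UNIV :: 'a set). x + 1) = (\<Sum>x\<in>UNIV. x)"
    by (rule sum.reindex_bij_betw) (auto intro!: bij_betw_byWitness[where f' = "\<lambda>x. x - 1"])
  thus ?thesis by (simp add: sum.distrib)
qed

lemma three_eq_0:
  assumes "card (UNIV :: 'a set) = 3 ^ m"
  shows "(3 :: 'a::{field,finite}) = 0"
  using of_nat_card_UNIV_eq_0[where 'a = 'a] assms by simp

text \<open>The factors of \<open>x ^ 3 - x\<close> are \<open>x\<close>, \<open>x - 1\<close> and
  \<open>x + 1\<close>. Describing the subfield as the fixed points of cubing turns "coefficients in
  the prime field" into invariance under \<open>frob\<close>.\<close>

lemma prime_subfield_char_3:
  assumes "(3 :: 'a::field) = 0"
  shows "prime_subfield = {0, 1, - 1 :: 'a}" and "card (prime_subfield :: 'a set) = 3"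
    and "(x :: 'a) \<in> prime_subfield \<longleftrightarrow> x ^ 3 = x"
proof -
  have two: "(2 :: 'a) = - 1" using assms by (simp add: eq_neg_iff_add_eq_0)
  have "of_nat k \<in> {0, 1, - 1 :: 'a}" for k
  proof -
    have "(of_nat k :: 'a) = of_nat (3 * (k div 3) + k mod 3)" by simp
    also have "\<dots> = of_nat (k mod 3)" unfolding of_nat_add of_nat_mult using assms by simp
    finally have *: "(of_nat k :: 'a) = of_nat (k mod 3)" .
    have "k mod 3 = 0 \<or> k mod 3 = 1 \<or> k mod 3 = 2" by presburger
    thus ?thesis unfolding * using two by (elim disjE) auto
  qed
  moreover have "{0, 1, - 1 :: 'a} = of_nat ` {0, 1, 2}"
    by (simp only: image_insert image_empty of_nat_0 of_nat_1 of_nat_numeral two)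
  ultimately show F: "prime_subfield = {0, 1, - 1 :: 'a}"
    unfolding prime_subfield_def by blast
  have "(1 :: 'a) \<noteq> - 1"
  proof
    assume "(1 :: 'a) = - 1"
    hence "(2 :: 'a) - 1 = 0" using two by simp
    thus False by simp
  qed
  thus "card (prime_subfield :: 'a set) = 3" unfolding F by simp
  have "x ^ 3 - x = x * (x - 1) * (x + 1)" by (simp add: algebra_simps power3_eq_cube)
  hence "x ^ 3 = x \<longleftrightarrow> x = 0 \<or> x = 1 \<or> x = - 1"
    by (metis eq_iff_diff_eq_0 mult_eq_0_iff eq_neg_iff_add_eq_0)
  thus "x \<in> prime_subfield \<longleftrightarrow> x ^ 3 = x" unfolding F by simp
qed

lemma map_poly_mult_hom:
  fixes f :: "'a::comm_semiring_0 \<Rightarrow> 'b::comm_semiring_0"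
  assumes "f 0 = 0" "\<And>x y. f (x + y) = f x + f y" "\<And>x y. f (x * y) = f x * f y"
  shows "map_poly f (p * q) = map_poly f p * map_poly f q"
proof (rule poly_eqI)
  fix k
  have "f (sum g A) = (\<Sum>i\<in>A. f (g i))" for g and A :: "nat set"
    by (induction A rule: infinite_finite_induct) (auto simp: assms)
  thus "coeff (map_poly f (p * q)) k = coeff (map_poly f p * map_poly f q) k"
    by (simp add: coeff_map_poly coeff_mult assms)
qed

lemma cube_add_char_3:
  fixes x y :: "'a::field"
  assumes "(3 :: 'a) = 0"
  shows "(x + y) ^ 3 = x ^ 3 + y ^ 3"
proof -
  have "(x + y) ^ 3 = x ^ 3 + y ^ 3 + 3 * (x\<^sup>2 * y + x * y\<^sup>2)"
    by (simp add: algebra_simps power3_eq_cube power2_eq_square)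
  thus ?thesis using assms by simp
qed

abbreviation frob :: "'a::field poly \<Rightarrow> 'a poly" where
  "frob \<equiv> map_poly (\<lambda>x. x ^ 3)"

lemma frob_mult:
  assumes "(3 :: 'a::field) = 0"
  shows "frob (p * q) = frob p * frob (q :: 'a poly)"
  by (rule map_poly_mult_hom) (auto simp: cube_add_char_3[OF assms] power_mult_distrib)

lemma frob_prod:
  assumes "(3 :: 'a::field) = 0"
  shows "frob (\<Prod>i\<in>A. p i) = (\<Prod>i\<in>A. frob (p i :: 'a poly))"
  by (induction A rule: infinite_finite_induct) (auto simp: frob_mult[OF assms])

lemma coeffs_in_prime_subfield_iff:
  assumes "(3 :: 'a::field) = 0"
  shows "(\<forall>i. coeff p i \<in> prime_subfield) \<longleftrightarrow> frob p = (p :: 'a poly)"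
  by (simp add: prime_subfield_char_3(3)[OF assms] poly_eq_iff coeff_map_poly)

section \<open>The generator polynomial and the number of codewords\<close>

lemma degree_gen_poly: "degree (gen_poly \<alpha> i1 i2 m) = card (T_set i1 i2 m)"
  unfolding gen_poly_def by (subst degree_prod_eq_sum_degree) auto

lemma gen_poly_nonzero: "gen_poly \<alpha> i1 i2 m \<noteq> 0"
  unfolding gen_poly_def by simp

text \<open>Cubing the coefficients sends the root \<open>\<alpha> ^ j\<close> to
  \<open>\<alpha> ^ (3 * j)\<close>, so the linear factors are merely permuted.\<close>

lemma frob_gen_poly:
  fixes \<alpha> :: "'a::field"
  assumes char: "(3 :: 'a) = 0" and m: "m > 0" and \<alpha>: "\<alpha> ^ (3 ^ m - 1) = 1"
  shows "frob (gen_poly \<alpha> i1 i2 m) = gen_poly \<alpha> i1 i2 m"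
proof -
  obtain l where l: "m = Suc l" using m by (cases m) auto
  \<comment> \<open>Cyclic rotation of the ternary digits is multiplication by 3 modulo \<open>3 ^ m - 1\<close>.\<close>
  define \<sigma> where "\<sigma> j = 3 * (j mod 3 ^ l) + j div 3 ^ l" for j :: nat
  let ?T = "T_set i1 i2 m"
  have split: "j = 3 ^ l * (j div 3 ^ l) + j mod 3 ^ l" for j :: nat by simp
  have top: "j div 3 ^ l < 3" if "j \<in> ?T" for j
  proof -
    have "j < 3 ^ Suc l" using that by (auto simp: T_set_def l)
    thus ?thesis by (simp add: less_mult_imp_div_less)
  qed
  have inj: "inj_on \<sigma> ?T"
  proof (rule inj_onI)
    fix i j assume ij: "i \<in> ?T" "j \<in> ?T" "\<sigma> i = \<sigma> j"
    have "c = d \<and> x = y" if "c < 3" "d < 3" "3 * x + c = 3 * y + d" for c d x y :: nat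
      using that by presburger
    from this[OF top[OF ij(1)] top[OF ij(2)] ij(3)[unfolded \<sigma>_def]]
    have "i div 3 ^ l = j div 3 ^ l \<and> i mod 3 ^ l = j mod 3 ^ l" .
    thus "i = j" using split[of i] split[of j] by simp
  qed
  have into: "\<sigma> j \<in> ?T" if j: "j \<in> ?T" for j
  proof -
    have r: "j mod 3 ^ l < 3 ^ l" by simp
    have "w3 j = w3 (j div 3 ^ l) + w3 (j mod 3 ^ l)"
      using w3_append[OF r, of "j div 3 ^ l"] by simp
    moreover have "w3 (\<sigma> j) = j div 3 ^ l + w3 (j mod 3 ^ l)"
      unfolding \<sigma>_def by (rule w3_step[OF top[OF j]])
    ultimately have w: "w3 (\<sigma> j) = w3 j" using w3_digit[OF top[OF j]] by simp
    have "\<sigma> j \<noteq> 0"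
    proof
      assume "\<sigma> j = 0"
      hence "j = 0" using split[of j] unfolding \<sigma>_def by simp
      thus False using j by (simp add: T_set_def)
    qed
    \<comment> \<open>Only the string with all digits 2 rotates to \<open>3 ^ m - 1\<close>, and
      that string is not in \<open>?T\<close>.\<close>
    moreover have "\<sigma> j \<le> 3 ^ m - 2"
    proof (rule ccontr)
      assume "\<not> \<sigma> j \<le> 3 ^ m - 2"
      hence "3 * 3 ^ l \<le> 3 * (j mod 3 ^ l) + j div 3 ^ l + 1"
        unfolding \<sigma>_def l by simp
      with r top[OF j] have "j div 3 ^ l = 2" "j mod 3 ^ l = 3 ^ l - 1" by linarith+
      hence "j = 3 ^ l * 2 + (3 ^ l - 1)" using split[of j] by simp
      moreover have "3 ^ l \<ge> (1::nat)" by simp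
      moreover have "j \<le> 3 * 3 ^ l - 2" using j by (simp add: T_set_def l)
      ultimately show False by linarith
    qed
    ultimately show ?thesis using j w by (auto simp: T_set_def)
  qed
  have img: "\<sigma> ` ?T = ?T"
    using inj into by (intro card_subset_eq) (auto simp: card_image)
  have pow: "\<alpha> ^ \<sigma> j = (\<alpha> ^ j) ^ 3" for j
  proof -
    \<comment> \<open>Moving the leading digit from place \<open>3 ^ m\<close> to place 1 changes
      the value by that digit times \<open>3 ^ m - 1\<close>.\<close>
    have "3 * j = \<sigma> j + (3 ^ m - 1) * (j div 3 ^ l)"
    proof -
      have "(3 ^ m - 1) * (j div 3 ^ l) + j div 3 ^ l = 3 ^ m * (j div 3 ^ l)"
        by (simp add: algebra_simps diff_mult_distrib)
      moreover have "3 * j = 3 ^ m * (j div 3 ^ l) + 3 * (j mod 3 ^ l)"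
        using arg_cong[OF split[of j], of "(*) 3"] unfolding l power_Suc distrib_left mult.assoc .
      ultimately show ?thesis unfolding \<sigma>_def by linarith
    qed
    hence "\<alpha> ^ (3 * j) = \<alpha> ^ \<sigma> j * (\<alpha> ^ (3 ^ m - 1)) ^ (j div 3 ^ l)"
      by (simp only: power_add power_mult)
    hence "\<alpha> ^ (j * 3) = \<alpha> ^ \<sigma> j" unfolding \<alpha> by (simp add: mult.commute)
    thus ?thesis by (simp add: power_mult)
  qed
  have neg: "(- x) ^ 3 = - (x ^ 3)" for x :: 'a by (simp add: power3_eq_cube)
  have "frob (gen_poly \<alpha> i1 i2 m) = (\<Prod>j\<in>?T. [:- (\<alpha> ^ \<sigma> j), 1:])"
    unfolding gen_poly_def frob_prod[OF char] by (simp add: map_poly_pCons pow neg)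
  also have "\<dots> = (\<Prod>j\<in>\<sigma> ` ?T. [:- (\<alpha> ^ j), 1:])"
    by (simp add: prod.reindex[OF inj])
  finally show ?thesis by (simp add: img gen_poly_def)
qed

text \<open>Bounding the degree through vanishing coefficients includes the zero polynomial and lets
  \<open>pCons\<close> drive the induction.\<close>

lemma card_polys_with_coeffs_in:
  fixes F :: "'a::zero set"
  assumes "0 \<in> F" "finite F"
  shows "finite {p. (\<forall>i. coeff p i \<in> F) \<and> (\<forall>i\<ge>k. coeff p i = 0)} \<and>
    card {p. (\<forall>i. coeff p i \<in> F) \<and> (\<forall>i\<ge>k. coeff p i = 0)} = card F ^ k"
proof (induction k)
  case 0
  have "{p. (\<forall>i. coeff p i \<in> F) \<and> (\<forall>i\<ge>0. coeff p i = 0)} = {0}"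
    using assms(1) by (auto simp: poly_eq_iff)
  thus ?case by simp
next
  case (Suc k)
  let ?S = "\<lambda>k. {p. (\<forall>i. coeff p i \<in> F) \<and> (\<forall>i\<ge>k. coeff p i = 0)}"
  have "?S (Suc k) = (\<lambda>(a, p). pCons a p) ` (F \<times> ?S k)"
  proof (rule set_eqI)
    fix p :: "'a poly"
    obtain a q where p: "p = pCons a q" by (rule pCons_cases)
    have "(\<forall>i. coeff (pCons a q) i \<in> F) \<longleftrightarrow> a \<in> F \<and> (\<forall>i. coeff q i \<in> F)"
      by (metis coeff_pCons_0 coeff_pCons_Suc not0_implies_Suc)
    moreover have "(\<forall>i\<ge>Suc k. coeff (pCons a q) i = 0) \<longleftrightarrow> (\<forall>i\<ge>k. coeff q i = 0)"
      by (metis Suc_le_D Suc_le_mono coeff_pCons_Suc)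
    ultimately show "p \<in> ?S (Suc k) \<longleftrightarrow> p \<in> (\<lambda>(a, p). pCons a p) ` (F \<times> ?S k)"
      unfolding p by auto
  qed
  moreover have "inj_on (\<lambda>(a, p). pCons a p) (F \<times> ?S k)" by (auto intro!: inj_onI)
  ultimately show ?case using Suc.IH assms(2) by (simp add: card_image card_cartesian_product)
qed

text \<open>Codewords are the products of the generator with cofactors over the prime field of
  degree below \<open>?k\<close>. The cofactor of a codeword is over that field because
  \<open>frob\<close> fixes both the product and the generator, which can be cancelled.\<close>

lemma card_code_C:
  fixes \<alpha> :: "'a::field"
  assumes char: "(3 :: 'a) = 0" and m: "m > 0" and \<alpha>: "\<alpha> ^ (3 ^ m - 1) = 1"
  shows "finite (code_C \<alpha> i1 i2 m)"
    and "card (code_C \<alpha> i1 i2 m) = 3 ^ (3 ^ m - 1 - card (T_set i1 i2 m))"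
proof -
  let ?g = "gen_poly \<alpha> i1 i2 m"
  let ?k = "3 ^ m - 1 - card (T_set i1 i2 m)"
  let ?Q = "{q :: 'a poly. (\<forall>i. coeff q i \<in> prime_subfield) \<and> (\<forall>i\<ge>?k. coeff q i = 0)}"
  have deg: "q = 0 \<or> degree (?g * q) < 3 ^ m - 1 \<longleftrightarrow> (\<forall>i\<ge>?k. coeff q i = 0)" for q
  proof (cases "q = 0")
    case False
    have "(\<forall>i\<ge>?k. coeff q i = 0) \<longleftrightarrow> degree q < ?k"
      using False coeff_eq_0[of q] leading_coeff_0_iff[of q] by (meson not_le order_less_le_trans)
    thus ?thesis using False by (auto simp: degree_mult_eq gen_poly_nonzero degree_gen_poly)
  qed simp
  have "code_C \<alpha> i1 i2 m = (\<lambda>q. ?g * q) ` ?Q"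
  proof (rule set_eqI)
    fix c
    have "?g * q \<in> code_C \<alpha> i1 i2 m \<longleftrightarrow> q \<in> ?Q" for q
      unfolding code_C_def cyclic_code_def mem_Collect_eq deg[symmetric]
        coeffs_in_prime_subfield_iff[OF char] frob_mult[OF char] frob_gen_poly[OF assms]
      by (simp add: gen_poly_nonzero)
    moreover have "?g dvd c" if "c \<in> code_C \<alpha> i1 i2 m"
      using that by (simp add: code_C_def cyclic_code_def)
    ultimately show "c \<in> code_C \<alpha> i1 i2 m \<longleftrightarrow> c \<in> (\<lambda>q. ?g * q) ` ?Q"
      by (auto elim!: dvdE)
  qed
  moreover have "inj_on (\<lambda>q. ?g * q) ?Q"
    by (auto intro!: inj_onI simp: gen_poly_nonzero)
  moreover have "finite ?Q \<and> card ?Q = 3 ^ ?k"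
  proof -
    have "0 \<in> (prime_subfield :: 'a set)" "finite (prime_subfield :: 'a set)"
      by (simp_all add: prime_subfield_char_3(1)[OF char])
    from card_polys_with_coeffs_in[OF this, of ?k] show ?thesis
      unfolding prime_subfield_char_3(2)[OF char] .
  qed
  ultimately show "finite (code_C \<alpha> i1 i2 m)" "card (code_C \<alpha> i1 i2 m) = 3 ^ ?k"
    by (simp_all add: card_image)
qed

section \<open>Long runs in the defining set\<close>

text \<open>The sign \<open>e\<close> covers both multipliers: \<open>e = - 1\<close> is
  \<open>n/2 - (3 ^ h + 1)\<close> and \<open>e = 1\<close> is \<open>n/2 + (3 ^ h - 1)\<close>. A
  common divisor is odd and turns out to divide 2.\<close>

lemma coprime_length:
  fixes b h :: nat and e :: int
  defines "n \<equiv> 3 ^ (2 * h + 1) - 1"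
  assumes "odd b" and "e\<^sup>2 = 1"
    and b: "2 * int b = int n + 2 * e * (3 ^ h - e)"
  shows "coprime b n"
proof (rule coprimeI)
  fix d assume d: "d dvd b" "d dvd n"
  have n: "int n = 3 * (3 ^ h)\<^sup>2 - 1"
    by (simp add: n_def of_nat_diff power_mult[symmetric] mult.commute)
  have d': "int d dvd int b" "int d dvd int n" using d by simp_all
  have cop: "coprime (int d) 2" using d(1) \<open>odd b\<close> by (auto dest: dvd_trans)
  have "2 * (e * (3 ^ h - e)) = 2 * int b - int n" using b by simp
  hence "int d dvd 2 * (e * (3 ^ h - e))" using d' by (auto intro!: dvd_diff)
  hence "int d dvd e * (3 ^ h - e)" using cop by (simp add: coprime_dvd_mult_right_iff)
  \<comment> \<open>The cofactor is chosen to produce \<open>3 * ((3 ^ h)\<^sup>2 - 1)\<close>,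
    which is \<open>n - 2\<close>.\<close>
  hence "int d dvd int n - e * (3 ^ h - e) * (3 * e * (3 ^ h + e))"
    using d'(2) by (intro dvd_diff) auto
  also have "int n - e * (3 ^ h - e) * (3 * e * (3 ^ h + e)) = 2"
  proof -
    have "e * (3 ^ h - e) * (3 * e * (3 ^ h + e)) = 3 * e\<^sup>2 * ((3 ^ h)\<^sup>2 - e\<^sup>2)"
      by (simp add: algebra_simps power2_eq_square)
    thus ?thesis by (simp add: n \<open>e\<^sup>2 = 1\<close>)
  qed
  finally have "int d dvd 2" .
  hence "is_unit (int d)" using cop by (meson coprime_common_divisor dvd_refl)
  thus "is_unit d" by simp
qed

lemma in_T_set_23I: "w3 j mod 4 \<in> {2, 3} \<Longrightarrow> j < 3 ^ m - 1 \<Longrightarrow> j \<in> T_set 2 3 m"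
  by (cases "j = 0") (auto simp: T_set_def)

lemma mod_in_T_set_23I:
  assumes "b * i = j + (3 ^ m - 1) * t" "j < 3 ^ m - 1" "w3 j mod 4 \<in> {2, 3}"
  shows "b * i mod (3 ^ m - 1) \<in> T_set 2 3 m"
proof -
  have "b * i mod (3 ^ m - 1) = j" using assms(1,2) by simp
  thus ?thesis using in_T_set_23I[OF assms(3,2)] by simp
qed

text \<open>The run has \<open>(3 ^ h + 3) / 2\<close> terms, one less than the claimed
  distance.\<close>

lemma run_m_mod_4_eq_1:
  fixes h :: nat
  defines "n \<equiv> 3 ^ (2 * h + 1) - 1"
  assumes h: "even h" "h > 0"
  shows "\<exists>b. coprime b n \<and>
    (\<forall>i. 1 \<le> i \<and> 2 * i \<le> 3 ^ h + 3 \<longrightarrow> b * i mod n \<in> T_set 2 3 (2 * h + 1))"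
proof -
  define P where "P = (3 :: nat) ^ h"
  have "odd P" by (simp add: P_def)
  then obtain N where N: "P = 2 * N + 1" by (elim oddE)
  have P9: "P \<ge> 9"
  proof -
    have "h \<ge> 2" using h by presburger
    hence "(3::nat) ^ 2 \<le> 3 ^ h" by (intro power_increasing) auto
    thus ?thesis by (simp add: P_def)
  qed
  have n: "n = 3 * P\<^sup>2 - 1" by (simp add: n_def P_def power_mult[symmetric] mult.commute)
  have PP: "9 * P \<le> P\<^sup>2" using mult_le_mono1[OF P9, of P] by (simp only: power2_eq_square)
  \<comment> \<open>\<open>M = N - 1\<close> lets \<open>b = n/2 - (P + 1)\<close> be written
    without subtraction.\<close>
  obtain M where M: "N = M + 1" using N P9 by (intro that[of "N - 1"]) auto
  have "even N"
  proof -
    have "P mod 4 = 1" using h(1) unfolding P_def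
      by (elim evenE) (simp add: power_mult, simp add: power_mod[of "9::nat" 4, symmetric])
    thus ?thesis using N by presburger
  qed
  define b where "b = P\<^sup>2 + (P + 1) * M"
  have n': "n + 1 = 3 * P\<^sup>2" using P9 by (simp add: n)
  have half: "2 * (P\<^sup>2 + (P + 1) * N) = n"
    using n' by (simp add: N algebra_simps power2_eq_square)
  have b2: "b + (P + 1) = P\<^sup>2 + (P + 1) * N" by (simp add: b_def M algebra_simps)
  have "coprime b n"
    unfolding n_def
  proof (rule coprime_length[where e = "- 1"])
    show "odd b" by (simp add: b_def N)
    show "2 * int b = int (3 ^ (2 * h + 1) - 1) + 2 * - 1 * (3 ^ h - - 1)"
      using arg_cong[OF half, of int] arg_cong[OF b2, of int] unfolding n_def[symmetric]
      by (simp add: P_def)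
  qed simp
  moreover have "b * i mod n \<in> T_set 2 3 (2 * h + 1)" if i: "1 \<le> i" "2 * i \<le> 3 ^ h + 3" for i
  proof (cases "even i")
    case True
    then obtain s where s: "i = 2 * s" by (elim evenE)
    have iP: "i < P" using i P9 unfolding P_def[symmetric] by simp
    \<comment> \<open>\<open>?r\<close> has two equal digit blocks \<open>i\<close>, and
      \<open>n - ?r\<close> is its digitwise complement. As \<open>w3 i\<close> is even, the weight
      is 2 modulo 4.\<close>
    let ?r = "P * i + i"
    have r: "?r < n"
    proof -
      have "?r \<le> P * (P - 1) + P" using iP by (intro add_mono mult_left_mono) auto
      also have "\<dots> = P\<^sup>2" using P9 by (simp add: power2_eq_square algebra_simps diff_mult_distrib2)
      also have "P\<^sup>2 < n" using n' P9 PP by linarith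
      finally show ?thesis .
    qed
    have "w3 ?r = 2 * w3 i" using w3_append[of i h i] iP by (simp add: P_def)
    moreover have "w3 ?r + w3 (n - ?r) = 2 * (2 * h + 1)"
      unfolding n_def using r by (intro w3_complement) (simp add: n_def)
    moreover have "even (w3 i)" using True by (simp add: even_w3_iff)
    ultimately have "w3 (n - ?r) mod 4 \<in> {2, 3}" by simp presburger
    moreover have "b * i = (n - ?r) + n * (s - 1)"
    proof -
      have "b * i + ?r = (b + (P + 1)) * i" by (simp add: algebra_simps)
      also have "\<dots> = n * s" unfolding b2 half[symmetric] s by (simp only: mult_ac)
      also have "\<dots> = n + n * (s - 1)" using s i by (cases s) auto
      finally show ?thesis using r by simp
    qed
    moreover have "n - ?r < n" using r i by simp
    ultimately show ?thesis unfolding n_def by (intro mod_in_T_set_23I) auto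
  next
    case False
    then obtain s where s: "i = 2 * s + 1" by (elim oddE)
    \<comment> \<open>The range allows \<open>N + 2\<close>, but that value is even.\<close>
    have iN: "i \<le> N + 1" using i(2) False \<open>even N\<close> unfolding P_def[symmetric] N
      by simp presburger
    define j where "j = P\<^sup>2 + (P + 1) * N - (P + 1) * i"
    have le: "(P + 1) * i \<le> P\<^sup>2 + (P + 1) * N"
    proof -
      have "(P + 1) * i \<le> (P + 1) * N + (P + 1)"
        using mult_le_mono2[OF iN, of "P + 1"] by (simp add: algebra_simps)
      moreover have "P + 1 \<le> P\<^sup>2" using P9 PP by linarith
      ultimately show ?thesis by linarith
    qed
    have "w3 j mod 4 \<in> {2, 3}"
    proof (cases "i \<le> N")
      case True
      \<comment> \<open>The blocks are 1, \<open>N - i\<close>, \<open>N - i\<close>; with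
        \<open>N - i\<close> odd the weight is 3 modulo 4.\<close>
      have j: "j = P * (P * 1 + (N - i)) + (N - i)"
      proof -
        obtain k where k: "N = i + k" using True by (auto simp: le_iff_add)
        show ?thesis unfolding j_def k by (simp add: algebra_simps power2_eq_square)
      qed
      have "N - i < 3 ^ h" using N by (simp add: P_def)
      hence "w3 j = w3 1 + w3 (N - i) + w3 (N - i)" unfolding j P_def by (simp only: w3_append)
      moreover have "odd (w3 (N - i))"
        using \<open>even N\<close> \<open>odd i\<close> True by (simp add: even_w3_iff)
      ultimately show ?thesis by (simp add: w3_digit) presburger
    next
      case False
      hence i_eq: "i = N + 1" using iN by simp
      \<comment> \<open>Here a borrow occurs: \<open>j = P * P - P - 1\<close> is the complement of
        \<open>P\<close> in \<open>2 * h\<close> digits.\<close>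
      have j: "j = 3 ^ (2 * h) - 1 - (P * 1 + 0)"
        unfolding j_def i_eq by (simp add: P_def power_mult[symmetric] mult.commute algebra_simps)
      have "w3 (P * 1 + 0) = 1"
        unfolding P_def by (subst w3_append) (auto simp: w3_digit)
      moreover have "w3 (P * 1 + 0) + w3 j = 2 * (2 * h)"
        unfolding j
      proof (rule w3_complement)
        have "P * 1 < P * P" using P9 by (intro mult_strict_left_mono) auto
        thus "P * 1 + 0 < 3 ^ (2 * h)"
          by (simp add: P_def mult_2 power_add)
      qed
      ultimately have "w3 j = 4 * h - 1" by linarith
      moreover have "4 * h - 1 = 3 + 4 * (h - 1)" using h(2) by simp
      hence "(4 * h - 1) mod 4 = 3" by simp
      ultimately show ?thesis by simp
    qed
    moreover have "b * i = j + n * s"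
    proof -
      have "b * i + (P + 1) * i = (b + (P + 1)) * i" by (simp add: algebra_simps)
      also have "\<dots> = n * s + (P\<^sup>2 + (P + 1) * N)"
        unfolding b2 half[symmetric] s by (simp add: algebra_simps)
      finally show ?thesis using le unfolding j_def by simp
    qed
    moreover have "j < n"
    proof -
      have "j \<le> P\<^sup>2 + (P + 1) * N" by (simp add: j_def)
      also have "\<dots> < 2 * (P\<^sup>2 + (P + 1) * N)" using P9 by simp
      finally show ?thesis using half by simp
    qed
    ultimately show ?thesis unfolding n_def by (intro mod_in_T_set_23I) auto
  qed
  ultimately show ?thesis by blast
qed

text \<open>With \<open>N = (3 ^ h - 1) / 2\<close> the run ends at \<open>N + 3\<close>, so the
  claimed distance is \<open>N + 4\<close>. From \<open>h > 1\<close> it follows that even indices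
  stay below \<open>3 ^ h\<close>.\<close>

lemma run_m_mod_4_eq_3:
  fixes h :: nat
  defines "n \<equiv> 3 ^ (2 * h + 1) - 1"
  assumes h: "odd h" "h > 1"
  shows "\<exists>b. coprime b n \<and>
    (\<forall>i. 1 \<le> i \<and> 2 * i \<le> 3 ^ h + 5 \<longrightarrow> b * i mod n \<in> T_set 2 3 (2 * h + 1))"
proof -
  define P where "P = (3 :: nat) ^ h"
  have "odd P" by (simp add: P_def)
  then obtain N where N: "P = 2 * N + 1" by (elim oddE)
  have P9: "P \<ge> 9"
  proof -
    have "(3::nat) ^ 2 \<le> 3 ^ h" using h(2) by (intro power_increasing) auto
    thus ?thesis by (simp add: P_def)
  qed
  have n: "n = 3 * P\<^sup>2 - 1" by (simp add: n_def P_def power_mult[symmetric] mult.commute)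
  have "odd N"
  proof -
    have "P mod 4 = 3" using h(1) unfolding P_def
      by (elim oddE) (simp add: power_mult, simp add: mod_mult_right_eq[symmetric, of 3 _ 4] power_mod[of "9::nat" 4, symmetric])
    thus ?thesis using N by presburger
  qed
  define H where "H = P\<^sup>2 + (P + 1) * N"
  define b where "b = H + 2 * N"
  have n': "n + 1 = 3 * P\<^sup>2" using P9 by (simp add: n)
  have half: "n = 2 * H"
    using n' by (simp add: H_def N algebra_simps power2_eq_square)
  have "coprime b n"
    unfolding n_def
  proof (rule coprime_length[where e = 1])
    show "odd b" by (simp add: b_def H_def N)
    have "int P = 2 * int N + 1" using N by simp
    thus "2 * int b = int (3 ^ (2 * h + 1) - 1) + 2 * 1 * (3 ^ h - 1)"
      using half unfolding n_def[symmetric] by (simp add: b_def P_def)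
  qed simp
  moreover have "b * i mod n \<in> T_set 2 3 (2 * h + 1)" if i: "1 \<le> i" "2 * i \<le> 3 ^ h + 5" for i
  proof (cases "even i")
    case True
    then obtain s where s: "i = 2 * s" by (elim evenE)
    have iP: "i < P" using i P9 unfolding P_def[symmetric] by simp
    \<comment> \<open>This is \<open>(P - 1) * i\<close> split into two complementary blocks, whence
      the weight \<open>2 * h\<close> whatever \<open>i\<close> is.\<close>
    define j where "j = P * (i - 1) + (P - 1 - (i - 1))"
    have j: "j = 2 * N * i"
    proof -
      obtain k where k: "i = Suc k" using i(1) by (cases i) auto
      show ?thesis using iP unfolding j_def by (simp add: k N algebra_simps)
    qed
    have "w3 j = w3 (i - 1) + w3 (P - 1 - (i - 1))"
      unfolding j_def P_def by (rule w3_append) simp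
    also have "\<dots> = 2 * h"
      unfolding P_def using iP by (intro w3_complement) (simp add: P_def)
    finally have "w3 j mod 4 \<in> {2, 3}" using h(1) by simp presburger
    moreover have "b * i = j + n * s" by (simp add: b_def j half s algebra_simps)
    moreover have "j < n"
    proof -
      have "j \<le> 2 * N * P" unfolding j using iP by (intro mult_le_mono2) simp
      also have "\<dots> < n" using half by (simp add: H_def N algebra_simps power2_eq_square)
      finally show ?thesis .
    qed
    ultimately show ?thesis unfolding n_def by (intro mod_in_T_set_23I) auto
  next
    case False
    then obtain s where s: "i = 2 * s + 1" by (elim oddE)
    \<comment> \<open>Since \<open>N\<close> is odd, \<open>N + 1\<close> and \<open>N + 3\<close>
      are even.\<close>
    have iN: "i \<le> N \<or> i = N + 2" using i(2) False \<open>odd N\<close> unfolding P_def[symmetric] N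
      by simp presburger
    define j where "j = H + 2 * N * i"
    have "w3 j mod 4 = 3"
      using iN
    proof
      assume le: "i \<le> N"
      \<comment> \<open>As \<open>P - 1 = 2 * N\<close>, the lowest block \<open>N - i\<close> is
        the complement of the middle block \<open>N + i\<close>.\<close>
      have j: "j = P * (P * 1 + (N + i)) + (P - 1 - (N + i))"
        using le unfolding j_def H_def by (simp add: N algebra_simps power2_eq_square)
      have lt: "N + i < 3 ^ h" "3 ^ h - 1 - (N + i) < (3::nat) ^ h"
        using le N unfolding P_def[symmetric] by auto
      have "w3 j = w3 1 + w3 (N + i) + w3 (3 ^ h - 1 - (N + i))"
        unfolding j P_def by (simp only: w3_append[OF lt(1)] w3_append[OF lt(2)])
      also have "\<dots> = 1 + 2 * h" using w3_complement[OF lt(1)] by (simp add: w3_digit)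
      finally show ?thesis using h(1) by simp presburger
    next
      assume i_eq: "i = N + 2"
      \<comment> \<open>Now \<open>N + i = P + 1\<close> overflows its block: after carry and borrow
        the blocks are 2, 0, \<open>P - 2\<close>, of total weight \<open>2 * h + 1\<close>.\<close>
      have j: "j = P * (P * 2 + 0) + (P - 1 - 1)"
        using P9 unfolding j_def H_def i_eq by (simp add: N algebra_simps power2_eq_square)
      have lt: "0 < (3::nat) ^ h" "3 ^ h - 1 - 1 < (3::nat) ^ h" "1 < (3::nat) ^ h"
        using P9 unfolding P_def[symmetric] by auto
      have "w3 j = w3 2 + w3 0 + w3 (3 ^ h - 1 - 1)"
        unfolding j P_def by (simp only: w3_append[OF lt(1)] w3_append[OF lt(2)])
      also have "\<dots> + w3 1 = 2 + 2 * h" using w3_complement[OF lt(3)] by (simp add: w3_digit)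
      finally show ?thesis using h(1) by (simp add: w3_digit) presburger
    qed
    moreover have "b * i = j + n * s" by (simp add: b_def j_def half s algebra_simps)
    moreover have "j < n"
    proof -
      have "i \<le> N + 2" using iN by auto
      hence "2 * N * i \<le> 2 * N * (N + 2)" by (rule mult_le_mono2)
      also have "\<dots> < H" using P9 unfolding H_def by (simp add: N algebra_simps power2_eq_square)
      finally show ?thesis using half by (simp add: j_def)
    qed
    ultimately show ?thesis unfolding n_def by (intro mod_in_T_set_23I) auto
  qed
  ultimately show ?thesis by blast
qed

text \<open>In base 3 these are 11, 12, 20, 21, of weights 2, 3, 2, 3.\<close>

lemma run_m_eq_3:
  assumes "4 \<le> t" "t \<le> 7"
  shows "t mod 26 \<in> T_set 2 3 3"
proof -
  have "t = 4 \<or> t = 5 \<or> t = 6 \<or> t = 7" using assms by arith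
  thus ?thesis
    by (elim disjE) (simp_all add: T_set_def w3_digit w3.simps[of 4] w3.simps[of 5] w3.simps[of 6] w3.simps[of 7])
qed

section \<open>Minimum distance and dimension\<close>

text \<open>Because \<open>b\<close> is prime to the length, \<open>\<alpha> ^ b\<close> has the
  same order as \<open>\<alpha>\<close>, and multiples of \<open>b\<close> become consecutive
  exponents for the BCH bound.\<close>

lemma min_dist_code_C_ge:
  fixes \<alpha> :: "'a::{field,finite}"
  assumes card: "card (UNIV :: 'a set) = 3 ^ m" and prim: "primitive_element \<alpha>" and m: "m > 0"
    and T: "card (T_set i1 i2 m) < 3 ^ m - 1"
    and b: "coprime b (3 ^ m - 1)"
    and run: "\<And>t. a \<le> t \<Longrightarrow> t + 1 < a + d \<Longrightarrow> b * t mod (3 ^ m - 1) \<in> T_set i1 i2 m"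
  shows "d \<le> min_dist (code_C \<alpha> i1 i2 m)"
proof -
  define n :: nat where "n = 3 ^ m - 1"
  have \<alpha>1: "\<alpha> ^ i = 1 \<longleftrightarrow> n dvd i" for i
    using primitive_element_power_eq_1_iff[OF prim] card by (simp add: n_def)
  have "\<alpha> \<noteq> 0" using prim by (simp add: primitive_element_def)
  define \<beta> where "\<beta> = \<alpha> ^ b"
  have nz: "\<beta> \<noteq> 0" using \<open>\<alpha> \<noteq> 0\<close> by (simp add: \<beta>_def)
  have inj: "inj_on (\<lambda>i. \<beta> ^ i) {..<n}"
  proof (rule power_eq_1_imp_inj_on[OF nz])
    fix i assume "\<beta> ^ i = 1"
    hence "n dvd b * i" by (simp add: \<beta>_def \<alpha>1 flip: power_mult)
    thus "n dvd i" using b unfolding n_def[symmetric]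
      by (simp add: coprime_dvd_mult_right_iff coprime_commute)
  qed
  have wt: "d \<le> hweight c" if c: "c \<in> code_C \<alpha> i1 i2 m - {0}" for c
  proof (rule BCH_bound[OF inj _ _ nz])
    show "c \<noteq> 0" using c by simp
    show "degree c < n" using c by (auto simp: code_C_def cyclic_code_def n_def)
    fix t assume t: "a \<le> t" "t + 1 < a + d"
    let ?j = "b * t mod n"
    have "\<beta> ^ t = \<alpha> ^ (n * (b * t div n) + ?j)" 
      by (simp only: \<beta>_def mult_div_mod_eq power_mult[symmetric])
    also have "\<dots> = \<alpha> ^ ?j" unfolding power_add using \<alpha>1[of "n * (b * t div n)"] by simp
    finally have \<beta>t: "\<beta> ^ t = \<alpha> ^ ?j" .
    have "?j \<in> T_set i1 i2 m" using run[OF t] by (simp add: n_def)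
    hence "poly (gen_poly \<alpha> i1 i2 m) (\<alpha> ^ ?j) = 0"
      by (auto simp: gen_poly_def poly_prod)
    moreover have "gen_poly \<alpha> i1 i2 m dvd c" using c by (simp add: code_C_def cyclic_code_def)
    ultimately show "poly c (\<beta> ^ t) = 0" unfolding \<beta>t by (auto elim!: dvdE)
  qed
  have char: "(3 :: 'a) = 0" by (rule three_eq_0[OF card])
  have \<alpha>n: "\<alpha> ^ (3 ^ m - 1) = 1" using \<alpha>1[of n] by (simp add: n_def)
  \<comment> \<open>\<open>Min\<close> is meaningful only on a nonempty set; positive dimension
    supplies a nonzero codeword.\<close>
  have "code_C \<alpha> i1 i2 m - {0} \<noteq> {}"
  proof
    assume "code_C \<alpha> i1 i2 m - {0} = {}"
    hence "card (code_C \<alpha> i1 i2 m) \<le> card {0 :: 'a poly}" by (intro card_mono) auto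
    moreover have "(3::nat) ^ 1 \<le> 3 ^ (3 ^ m - 1 - card (T_set i1 i2 m))"
      using T by (intro power_increasing) auto
    ultimately show False using card_code_C(2)[OF char m \<alpha>n, of i1 i2] by simp
  qed
  thus ?thesis unfolding min_dist_def
    using card_code_C(1)[OF char m \<alpha>n, of i1 i2] wt by (subst Min_ge_iff) auto
qed

lemma code_dim_code_C:
  fixes \<alpha> :: "'a::{field,finite}"
  assumes card: "card (UNIV :: 'a set) = 3 ^ m" and prim: "primitive_element \<alpha>" and m: "m > 0"
  shows "code_dim (code_C \<alpha> i1 i2 m) = 3 ^ m - 1 - card (T_set i1 i2 m)"
proof -
  have "\<alpha> ^ (3 ^ m - 1) = 1"
    using primitive_element_power_eq_1_iff[OF prim, of "3 ^ m - 1"] card by simp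
  from card_code_C(2)[OF three_eq_0[OF card] m this] show ?thesis
    unfolding code_dim_def by (intro the_equality) auto
qed

theorem theorem6:
  fixes \<alpha> :: "'a::{field,finite}" and m :: nat
  assumes "m \<ge> 3" and "odd m"
    and "card (UNIV :: 'a set) = 3 ^ m"
    and "primitive_element \<alpha>"
  defines "n \<equiv> 3 ^ m - 1"
  shows "(m mod 4 = 3 \<longrightarrow>
            real (min_dist (code_C \<alpha> 2 3 m)) \<ge> (3 ^ ((m - 1) div 2) + 7) / 2 \<and>
            code_dim (code_C \<alpha> 2 3 m) = n div 2)
       \<and> (m mod 4 = 1 \<longrightarrow>
            real (min_dist (code_C \<alpha> 2 3 m)) \<ge> (3 ^ ((m - 1) div 2) + 5) / 2 \<and>
            code_dim (code_C \<alpha> 2 3 m) = (n + 2) div 2)"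
proof -
  obtain h where h: "m = 2 * h + 1" using \<open>odd m\<close> by (elim oddE)
  hence half: "(m - 1) div 2 = h" by simp
  have m0: "m > 0" using \<open>m \<ge> 3\<close> by simp
  have dim: "code_dim (code_C \<alpha> 2 3 m) = n - card (T_set 2 3 m)"
    using code_dim_code_C[OF assms(3,4) m0] by (simp add: n_def)
  have n: "int n = 3 ^ m - 1" by (simp add: n_def of_nat_diff)
  have T: "2 * int (card (T_set 2 3 m)) = int n + residue_sign m - 1"
    using card_T_set_23[OF \<open>odd m\<close>] n by simp
  have "(3::nat) ^ 3 \<le> 3 ^ m" using \<open>m \<ge> 3\<close> by (intro power_increasing) auto
  hence "n \<ge> 2" by (simp add: n_def)
  hence T_less: "card (T_set 2 3 m) < 3 ^ m - 1"
    using T unfolding n_def[symmetric] by (auto simp: residue_sign_def split: if_splits)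
  note dist = min_dist_code_C_ge[OF assms(3,4) m0 T_less]
  \<comment> \<open>\<open>3 ^ h + c\<close> is even, so \<open>div\<close> loses nothing against
    real division.\<close>
  have real_ge: "real (min_dist (code_C \<alpha> 2 3 m)) \<ge> (3 ^ h + real c) / 2"
    if "odd c" "(3 ^ h + c) div 2 \<le> min_dist (code_C \<alpha> 2 3 m)" for c
  proof -
    have "even (3 ^ h + c)" using that(1) by simp
    hence "2 * ((3 ^ h + c) div 2) = 3 ^ h + c" by (rule even_two_times_div_two)
    hence "3 ^ h + c \<le> 2 * min_dist (code_C \<alpha> 2 3 m)" using that(2) by linarith
    hence "real (3 ^ h + c) \<le> real (2 * min_dist (code_C \<alpha> 2 3 m))" by (simp only: of_nat_le_iff)
    thus ?thesis by simp
  qed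
  show ?thesis
  proof (intro conjI impI)
    assume m3: "m mod 4 = 3"
    hence "odd h" using h by presburger
    have "(3 ^ h + 7) div 2 \<le> min_dist (code_C \<alpha> 2 3 m)"
    proof (cases "h = 1")
      case True
      show ?thesis
        \<comment> \<open>Here \<open>b = 1\<close> and the run starts at 4; the distance
          \<open>(3 + 7) / 2 = 5\<close> needs exactly four exponents.\<close>
        using True h run_m_eq_3 by (intro dist[of 1 4]) auto
    next
      case False
      hence "h > 1" using \<open>odd h\<close> by (cases h) auto
      from run_m_mod_4_eq_3[OF \<open>odd h\<close> this] obtain b where b: "coprime b (3 ^ m - 1)"
        and run: "\<And>i. 1 \<le> i \<Longrightarrow> 2 * i \<le> 3 ^ h + 5 \<Longrightarrow> b * i mod (3 ^ m - 1) \<in> T_set 2 3 m"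
        unfolding h by blast
      show ?thesis by (rule dist[OF b, of 1], rule run) auto
    qed
    from real_ge[of 7, OF _ this]
    show "real (min_dist (code_C \<alpha> 2 3 m)) \<ge> (3 ^ ((m - 1) div 2) + 7) / 2"
      unfolding half by simp
    have "residue_sign m = 1" using m3 by (simp add: residue_sign_def)
    thus "code_dim (code_C \<alpha> 2 3 m) = n div 2" using T dim by linarith
  next
    assume m1: "m mod 4 = 1"
    hence "even h" using h by presburger
    have "h > 0" using h \<open>m \<ge> 3\<close> by simp
    from run_m_mod_4_eq_1[OF \<open>even h\<close> this] obtain b where b: "coprime b (3 ^ m - 1)"
      and run: "\<And>i. 1 \<le> i \<Longrightarrow> 2 * i \<le> 3 ^ h + 3 \<Longrightarrow> b * i mod (3 ^ m - 1) \<in> T_set 2 3 m"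
      unfolding h by blast
    have "(3 ^ h + 5) div 2 \<le> min_dist (code_C \<alpha> 2 3 m)"
      by (rule dist[OF b, of 1], rule run) auto
    from real_ge[of 5, OF _ this]
    show "real (min_dist (code_C \<alpha> 2 3 m)) \<ge> (3 ^ ((m - 1) div 2) + 5) / 2"
      unfolding half by simp
    have "residue_sign m = - 1" using m1 by (simp add: residue_sign_def)
    thus "code_dim (code_C \<alpha> 2 3 m) = (n + 2) div 2" using T dim by linarith
  qed
qed

end
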